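(* Let $u,v\in\mathbb{N}\cup\{\omega\}$, let $S$ be a nontrivial subsemigroup of $(\mathbb{Q},+)$, and let $B$ be a $u\times v$ matrix with rational entries. Then there is a $v\times v$ matrix $C$ with rational entries such that $$\{\vec x\in(S\setminus\{0\})^v:B\vec x=\vec 0\}=\{C\vec y:\vec y\in(S\setminus\{0\})^v\}\cap(S\setminus\{0\})^v.$$ Further, $B$ is kernel partition regular over $S$ if and only if $C$ is image partition regular over $S$.
   Context: $\mathbb{N}$ is the set of positive integers, $\omega=\{0,1,2,\dots\}$; each $u\in\mathbb{N}$ is identified with $\{0,\dots,u-1\}$, a $u\times v$ matrix has rows indexed by $u$ and columns by $v$, and all matrices considered have finitely many nonzero entries in each row. $S$ nontrivial means $S\neq\{0\}$. A finite colouring is a function with finite range; monochromatic means constant colour. A matrix $M$ with $w$ columns is kernel partition regular over $S$ if for every finite colouring of $S\setminus\{0\}$ there is $\vec x\in(S\setminus\{0\})^w$ with $M\vec x=\vec 0$ and the entries of $\vec x$ monochromatic; it is image partition regular over $S$ if for every finite colouring of $S\setminus\{0\}$ there is $\vec x\in(S\setminus\{0\})^w$ with the entries of $M\vec x$ in $S\setminus\{0\}$ and monochromatic. *)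

theory Defs
  imports Complex_Main "HOL-Library.FuncSet" "HOL-Library.Extended_Nat"
begin

text \<open>
  Sizes range over the nonzero elements of \<^typ>\<open>enat\<close>, with \<open>\<infinity>\<close> in the role of \<open>\<omega>\<close>.
  A \<open>u \<times> v\<close> matrix is represented by a function \<open>nat \<Rightarrow> nat \<Rightarrow> rat\<close> of which only the
  entries in \<open>idx u \<times> idx v\<close> matter. Vectors are extensional functions on their
  index set, so that equality of vectors is equality of their entries.
\<close>

definition idx :: "enat \<Rightarrow> nat set" where
  "idx u = {i. enat i < u}"

definition finite_rows :: "enat \<Rightarrow> enat \<Rightarrow> (nat \<Rightarrow> nat \<Rightarrow> rat) \<Rightarrow> bool" where
  "finite_rows u v A \<longleftrightarrow> (\<forall>i\<in>idx u. finite {j \<in> idx v. A i j \<noteq> 0})"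

definition vecs :: "enat \<Rightarrow> rat set \<Rightarrow> (nat \<Rightarrow> rat) set" where
  "vecs v X = idx v \<rightarrow>\<^sub>E X"

definition zero_vec :: "enat \<Rightarrow> nat \<Rightarrow> rat" where
  "zero_vec u = (\<lambda>i\<in>idx u. 0)"

text \<open>
  The sum runs over the support of the row, which is finite under \<^const>\<open>finite_rows\<close>;
  summing over \<open>idx v\<close> would give \<open>0\<close> by convention when \<open>v = \<infinity>\<close>.
\<close>

definition mat_vec :: "enat \<Rightarrow> enat \<Rightarrow> (nat \<Rightarrow> nat \<Rightarrow> rat) \<Rightarrow> (nat \<Rightarrow> rat) \<Rightarrow> nat \<Rightarrow> rat" where
  "mat_vec u v A x = (\<lambda>i\<in>idx u. \<Sum>j\<in>{j \<in> idx v. A i j \<noteq> 0}. A i j * x j)"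

definition subsemigroup :: "'a::semigroup_add set \<Rightarrow> bool" where
  "subsemigroup S \<longleftrightarrow> S \<noteq> {} \<and> (\<forall>x\<in>S. \<forall>y\<in>S. x + y \<in> S)"

text \<open>Colours are natural numbers, which is no restriction for colourings with finite range.\<close>

definition finite_colouring :: "'a set \<Rightarrow> ('a \<Rightarrow> nat) \<Rightarrow> bool" where
  "finite_colouring X \<chi> \<longleftrightarrow> finite (\<chi> ` X)"

definition monochromatic :: "('a \<Rightarrow> nat) \<Rightarrow> 'a set \<Rightarrow> bool" where
  "monochromatic \<chi> A \<longleftrightarrow> (\<exists>c. \<forall>a\<in>A. \<chi> a = c)"

definition kernel_partition_regular ::
    "rat set \<Rightarrow> enat \<Rightarrow> enat \<Rightarrow> (nat \<Rightarrow> nat \<Rightarrow> rat) \<Rightarrow> bool" where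
  "kernel_partition_regular S u v M \<longleftrightarrow>
     (\<forall>\<chi>. finite_colouring (S - {0}) \<chi> \<longrightarrow>
        (\<exists>x\<in>vecs v (S - {0}). mat_vec u v M x = zero_vec u \<and> monochromatic \<chi> (x ` idx v)))"

definition image_partition_regular ::
    "rat set \<Rightarrow> enat \<Rightarrow> enat \<Rightarrow> (nat \<Rightarrow> nat \<Rightarrow> rat) \<Rightarrow> bool" where
  "image_partition_regular S u v M \<longleftrightarrow>
     (\<forall>\<chi>. finite_colouring (S - {0}) \<chi> \<longrightarrow>
        (\<exists>x\<in>vecs v (S - {0}). mat_vec u v M x \<in> vecs u (S - {0}) \<and>
           monochromatic \<chi> (mat_vec u v M x ` idx u)))"

end

theory Submission imports Defs begin

text \<open>
  It suffices that \<open>C\<close> fixes every solution \<open>x\<close> and that \<open>B (C y) = 0\<close> for all \<open>y\<close>. Such a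
  row-finite \<open>C\<close> comes from reducing unit vectors: let \<open>R\<close> be the space of finitely supported
  rows that annihilate all solutions, and let row \<open>n\<close> of \<open>C\<close> be the normal form of the unit vector
  \<open>e\<^sub>n\<close> modulo \<open>R\<close>, which is supported off the leading positions of \<open>R\<close>. As \<open>e\<^sub>n\<close> minus its normal
  form lies in \<open>R\<close>, \<open>C\<close> fixes the solutions. Any combination of the rows of \<open>C\<close> whose coefficient
  vector lies in \<open>R\<close> is an element of \<open>R\<close> that vanishes at all leading positions, hence is \<open>0\<close>;
  this applies to the rows of \<open>B\<close>.
\<close>

text \<open>The leading position of a row is its last nonzero index. Taking the last index rather
  than the first means that reduction only brings in smaller indices, so it terminates and the
  normal form of \<open>e\<^sub>n\<close> lives on \<open>{..n}\<close>.\<close>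

definition leading_positions :: "(nat \<Rightarrow> 'a::zero) set \<Rightarrow> nat set" where
  "leading_positions R = {n. \<exists>r\<in>R. r n \<noteq> 0 \<and> (\<forall>j>n. r j = 0)}"

lemma sum_closed_pointwise:
  fixes f :: "'i \<Rightarrow> 'b \<Rightarrow> 'a::comm_monoid_add"
  assumes "(\<lambda>_. 0) \<in> R"
    and "\<And>r s. r \<in> R \<Longrightarrow> s \<in> R \<Longrightarrow> (\<lambda>k. r k + s k) \<in> R"
    and "\<And>i. i \<in> I \<Longrightarrow> f i \<in> R"
  shows "(\<lambda>k. \<Sum>i\<in>I. f i k) \<in> R"
  using assms(3)
proof (induction I rule: infinite_finite_induct)
  case (insert i I)
  then show ?case using assms(2)[of "f i" "\<lambda>k. \<Sum>i\<in>I. f i k"] by simp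
qed (use assms(1) in auto)

lemma unit_vector_normal_form:
  fixes R :: "(nat \<Rightarrow> 'a::field) set"
  assumes zero: "(\<lambda>_. 0) \<in> R"
    and add: "\<And>r s. r \<in> R \<Longrightarrow> s \<in> R \<Longrightarrow> (\<lambda>k. r k + s k) \<in> R"
    and scale: "\<And>a r. r \<in> R \<Longrightarrow> (\<lambda>k. a * r k) \<in> R"
  shows "\<exists>c. (\<forall>j. c j \<noteq> 0 \<longrightarrow> j \<le> n \<and> j \<notin> leading_positions R) \<and>
             (\<lambda>k. of_bool (k = n) - c k) \<in> R"
proof (induction n rule: less_induct)
  case (less n)
  show ?case
  proof (cases "n \<in> leading_positions R")
    case False
    then show ?thesis using zero by (intro exI[of _ "\<lambda>k. of_bool (k = n)"]) auto
  next
    case True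
    then obtain r where r: "r \<in> R" "r n \<noteq> 0" "\<And>j. j > n \<Longrightarrow> r j = 0"
      by (auto simp: leading_positions_def)
    obtain d where d: "\<And>i j. i < n \<Longrightarrow> d i j \<noteq> 0 \<Longrightarrow> j \<le> i \<and> j \<notin> leading_positions R"
      "\<And>i. i < n \<Longrightarrow> (\<lambda>k. of_bool (k = i) - d i k) \<in> R"
      using less by metis
    \<comment> \<open>Modulo \<open>R\<close> the row \<open>r / r n\<close> vanishes, so
      \<open>e\<^sub>n\<close> is congruent to minus the sum of \<open>(r i / r n) e\<^sub>i\<close>
      over \<open>i < n\<close>; each \<open>e\<^sub>i\<close> is replaced by its normal form
      \<open>d i\<close>.\<close>
    define c where "c = (\<lambda>k. \<Sum>i<n. - (r i / r n) * d i k)"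
    have "(\<lambda>k. (1 / r n) * r k + (\<Sum>i<n. - (r i / r n) * (of_bool (k = i) - d i k))) \<in> R"
      by (intro add scale r sum_closed_pointwise zero d) auto
    also have "(\<lambda>k. (1 / r n) * r k + (\<Sum>i<n. - (r i / r n) * (of_bool (k = i) - d i k)))
        = (\<lambda>k. of_bool (k = n) - c k)"
    proof
      fix k
      have "(\<Sum>i<n. - (r i / r n) * (of_bool (k = i) - d i k))
          = - (\<Sum>i<n. if k = i then r i / r n else 0) - c k"
        unfolding c_def sum_negf[symmetric] sum_subtractf[symmetric]
        by (intro sum.cong) (auto simp: algebra_simps)
      also have "(\<Sum>i<n. if k = i then r i / r n else 0) = (if k < n then r k / r n else 0)"
        by simp
      finally show "(1 / r n) * r k + (\<Sum>i<n. - (r i / r n) * (of_bool (k = i) - d i k))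
          = of_bool (k = n) - c k"
        using r(2) r(3)[of k] by (cases k n rule: linorder_cases) auto
    qed
    finally have "(\<lambda>k. of_bool (k = n) - c k) \<in> R" .
    moreover have "j \<le> n \<and> j \<notin> leading_positions R" if cj: "c j \<noteq> 0" for j
    proof -
      obtain i where "i < n" "d i j \<noteq> 0"
        using cj unfolding c_def by (elim sum.not_neutral_contains_not_neutral) auto
      then show ?thesis using d(1)[of i j] by auto
    qed
    ultimately show ?thesis by blast
  qed
qed

lemma combination_of_normal_forms_eq_0:
  fixes R :: "(nat \<Rightarrow> 'a::field) set"
  assumes zero: "(\<lambda>_. 0) \<in> R"
    and add: "\<And>r s. r \<in> R \<Longrightarrow> s \<in> R \<Longrightarrow> (\<lambda>k. r k + s k) \<in> R"
    and scale: "\<And>a r. r \<in> R \<Longrightarrow> (\<lambda>k. a * r k) \<in> R"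
    and fin: "\<And>r. r \<in> R \<Longrightarrow> finite {k. r k \<noteq> 0}"
    and nonlead: "\<And>i j. c i j \<noteq> 0 \<Longrightarrow> j \<notin> leading_positions R"
    and cong: "\<And>i. (\<lambda>k. of_bool (k = i) - c i k) \<in> R"
    and "r \<in> R"
  shows "(\<Sum>i | r i \<noteq> 0. r i * c i k) = 0"
proof (rule ccontr)
  assume nz: "(\<Sum>i | r i \<noteq> 0. r i * c i k) \<noteq> 0"
  define t where "t = (\<lambda>k. \<Sum>i | r i \<noteq> 0. r i * c i k)"
  \<comment> \<open>Since \<open>r\<close> is the sum of the \<open>r i e\<^sub>i\<close>,
    subtracting the elements \<open>r i (e\<^sub>i - c i)\<close> of \<open>R\<close> from
    \<open>r\<close> leaves exactly \<open>t\<close>.\<close>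
  have "(\<lambda>k. r k + (\<Sum>i | r i \<noteq> 0. - r i * (of_bool (k = i) - c i k))) \<in> R"
    by (intro add scale \<open>r \<in> R\<close> sum_closed_pointwise zero cong)
  also have "(\<lambda>k. r k + (\<Sum>i | r i \<noteq> 0. - r i * (of_bool (k = i) - c i k))) = t"
  proof
    fix k
    have "(\<Sum>i | r i \<noteq> 0. - r i * (of_bool (k = i) - c i k))
        = t k - (\<Sum>i | r i \<noteq> 0. if k = i then r i else 0)"
      unfolding t_def sum_subtractf[symmetric] by (intro sum.cong) (auto simp: algebra_simps)
    also have "(\<Sum>i | r i \<noteq> 0. if k = i then r i else 0) = r k"
      using fin[OF \<open>r \<in> R\<close>] by (simp add: sum.delta)
    finally show "r k + (\<Sum>i | r i \<noteq> 0. - r i * (of_bool (k = i) - c i k)) = t k" by simp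
  qed
  finally have "t \<in> R" .
  \<comment> \<open>The last nonzero index of \<open>t\<close> is a leading position because
    \<open>t\<close> is in \<open>R\<close>, yet every row \<open>c i\<close> vanishes
    there.\<close>
  define m where "m = Max {k. t k \<noteq> 0}"
  have ne: "finite {k. t k \<noteq> 0}" "{k. t k \<noteq> 0} \<noteq> {}"
    using fin[OF \<open>t \<in> R\<close>] nz unfolding t_def by auto
  have "t m \<noteq> 0" using Max_in[OF ne] by (simp add: m_def)
  moreover have "t j = 0" if "j > m" for j
    using Max_ge[OF ne(1), of j] that by (auto simp: m_def)
  ultimately have "m \<in> leading_positions R"
    using \<open>t \<in> R\<close> by (auto simp: leading_positions_def)
  moreover obtain i where "c i m \<noteq> 0"
    using \<open>t m \<noteq> 0\<close> unfolding t_def by (elim sum.not_neutral_contains_not_neutral) auto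
  ultimately show False using nonlead by blast
qed

lemma idx_downward_closed: "i \<in> idx v \<Longrightarrow> j \<le> i \<Longrightarrow> j \<in> idx v"
  unfolding idx_def by (auto intro: le_less_trans[of "enat j" "enat i"])

text \<open>\<open>K\<close> enters only through its annihilator \<open>R\<close>, which is a
  subspace for any \<open>K\<close>. This matters because the solutions with entries in
  \<open>S - {0}\<close> do not form a subspace.\<close>

lemma exists_projection_onto_kernel:
  fixes K :: "(nat \<Rightarrow> rat) set"
  assumes B: "finite_rows u v B"
    and K: "\<And>x. x \<in> K \<Longrightarrow> mat_vec u v B x = zero_vec u"
  obtains C where "finite_rows v v C"
    and "\<And>x i. x \<in> K \<Longrightarrow> i \<in> idx v \<Longrightarrow> mat_vec v v C x i = x i"
    and "\<And>y. mat_vec u v B (mat_vec v v C y) = zero_vec u"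
proof -
  define R :: "(nat \<Rightarrow> rat) set" where
    "R = {r. finite {k. r k \<noteq> 0} \<and> (\<forall>x\<in>K. (\<Sum>k | r k \<noteq> 0. r k * x k) = 0)}"
  \<comment> \<open>Testing membership over any finite superset of the support lets rows with
    different supports be added under one index set.\<close>
  have R_iff: "r \<in> R \<longleftrightarrow> (\<forall>x\<in>K. (\<Sum>k\<in>A. r k * x k) = 0)"
    if "finite A" "{k. r k \<noteq> 0} \<subseteq> A" for r A
  proof -
    have "(\<Sum>k | r k \<noteq> 0. r k * x k) = (\<Sum>k\<in>A. r k * x k)" for x :: "nat \<Rightarrow> rat"
      using that by (intro sum.mono_neutral_left) auto
    then show ?thesis using that finite_subset unfolding R_def by auto
  qed
  have fin: "finite {k. r k \<noteq> 0}" if "r \<in> R" for r using that by (simp add: R_def)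
  have zero: "(\<lambda>_. 0) \<in> R" by (simp add: R_def)
  have add: "(\<lambda>k. r k + s k) \<in> R" if "r \<in> R" "s \<in> R" for r s
  proof -
    let ?A = "{k. r k \<noteq> 0} \<union> {k. s k \<noteq> 0}"
    have A: "finite ?A" using that fin by auto
    have "\<forall>x\<in>K. (\<Sum>k\<in>?A. r k * x k) = 0" "\<forall>x\<in>K. (\<Sum>k\<in>?A. s k * x k) = 0"
      using R_iff[OF A, of r] R_iff[OF A, of s] that by auto
    moreover have "{k. r k + s k \<noteq> 0} \<subseteq> ?A" by auto
    ultimately show ?thesis
      using R_iff[OF A, of "\<lambda>k. r k + s k"] by (simp add: distrib_right sum.distrib)
  qed
  have scale: "(\<lambda>k. a * r k) \<in> R" if "r \<in> R" for a r
    using R_iff[OF fin[OF that], of "\<lambda>k. a * r k"] that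
    by (auto simp: R_def mult.assoc sum_distrib_left[symmetric])
  obtain C where nonlead: "\<And>i j. C i j \<noteq> 0 \<Longrightarrow> j \<notin> leading_positions R"
    and le: "\<And>i j. C i j \<noteq> 0 \<Longrightarrow> j \<le> i"
    and cong: "\<And>i. (\<lambda>k. of_bool (k = i) - C i k) \<in> R"
    using unit_vector_normal_form[OF zero add scale] by metis
  \<comment> \<open>\<open>C\<close> is lower triangular and \<open>{..i}\<close> lies inside
    \<open>idx v\<close>, so the restriction of columns to \<open>idx v\<close> loses nothing, even
    for finite \<open>v\<close>.\<close>
  have C_sum: "mat_vec v v C y i = (\<Sum>k\<le>i. C i k * y k)" if "i \<in> idx v" for y i
    unfolding mat_vec_def using that le idx_downward_closed
    by (auto intro!: sum.mono_neutral_left)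
  have "finite_rows v v C"
    unfolding finite_rows_def using le by (auto intro: finite_subset[of _ "{.._}"])
  moreover have "mat_vec v v C x i = x i" if "x \<in> K" "i \<in> idx v" for x i
  proof -
    have "{k. of_bool (k = i) - C i k \<noteq> 0} \<subseteq> {..i}" using le[of i] by auto
    then have "(\<Sum>k\<le>i. (of_bool (k = i) - C i k) * x k) = 0"
      using R_iff[of "{..i}" "\<lambda>k. of_bool (k = i) - C i k"] cong[of i] that(1) by blast
    moreover have "(\<Sum>k\<le>i. of_bool (k = i) * x k) = (\<Sum>k\<le>i. if k = i then x k else 0)"
      by (intro sum.cong) auto
    ultimately show ?thesis
      using C_sum[OF that(2)] by (simp add: left_diff_distrib sum_subtractf)
  qed
  moreover have "mat_vec u v B (mat_vec v v C y) = zero_vec u" for y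
  proof
    fix l
    show "mat_vec u v B (mat_vec v v C y) l = zero_vec u l"
    proof (cases "l \<in> idx u")
      case True
      \<comment> \<open>Entries of \<open>B\<close> outside \<open>idx v\<close> are arbitrary;
        cutting them off turns row \<open>l\<close> into a finitely supported row on all of
        \<open>nat\<close>.\<close>
      define b where "b = (\<lambda>j. if j \<in> idx v then B l j else 0)"
      have supp: "{j. b j \<noteq> 0} = {j \<in> idx v. B l j \<noteq> 0}" by (auto simp: b_def)
      have finb: "finite {j. b j \<noteq> 0}"
        using B True unfolding supp finite_rows_def by blast
      have Bl: "mat_vec u v B x l = (\<Sum>j | b j \<noteq> 0. b j * x j)" for x
        unfolding mat_vec_def supp using True by (auto intro!: sum.cong simp: b_def)
      have "(\<Sum>j | b j \<noteq> 0. b j * x j) = 0" if "x \<in> K" for x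
        using Bl[of x] K[OF that] True by (simp add: zero_vec_def)
      then have "b \<in> R" using finb by (simp add: R_def)
      \<comment> \<open>By triangularity \<open>N\<close> bounds all inner sums at once, so the
        finite sums can be swapped to give \<open>B (C y) = (B C) y\<close>. If
        \<open>b = 0\<close>, the value of \<open>N\<close> is unspecified, but the outer sum is
        empty.\<close>
      define N where "N = Max {j. b j \<noteq> 0}"
      have N: "i \<le> N" if "b i \<noteq> 0" for i
        using that finb by (simp add: N_def)
      have "mat_vec u v B (mat_vec v v C y) l = (\<Sum>i | b i \<noteq> 0. b i * (\<Sum>k\<le>N. C i k * y k))"
        unfolding Bl
      proof (intro sum.cong refl arg_cong2[of _ _ _ _ "(*)"])
        fix i assume i: "i \<in> {i. b i \<noteq> 0}"
        then have "i \<in> idx v" using supp by auto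
        then have "mat_vec v v C y i = (\<Sum>k\<le>i. C i k * y k)" by (rule C_sum)
        also have "\<dots> = (\<Sum>k\<le>N. C i k * y k)"
          using N[of i] i le[of i] by (intro sum.mono_neutral_left) auto
        finally show "mat_vec v v C y i = (\<Sum>k\<le>N. C i k * y k)" .
      qed
      also have "\<dots> = (\<Sum>k\<le>N. (\<Sum>i | b i \<noteq> 0. b i * C i k) * y k)"
        unfolding sum_distrib_left sum_distrib_right mult.assoc by (rule sum.swap)
      also have "\<dots> = 0"
      proof (rule sum.neutral, rule ballI)
        fix k
        have "(\<Sum>i | b i \<noteq> 0. b i * C i k) = 0"
          by (rule combination_of_normal_forms_eq_0[where R = R])
            (fact zero add scale fin nonlead cong \<open>b \<in> R\<close>)+
        then show "(\<Sum>i | b i \<noteq> 0. b i * C i k) * y k = 0" by simp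
      qed
      finally show ?thesis using True by (simp add: zero_vec_def)
    qed (simp add: mat_vec_def zero_vec_def)
  qed
  ultimately show thesis by (rule that)
qed

theorem theorem2p4:
  fixes u v :: enat and S :: "rat set" and B :: "nat \<Rightarrow> nat \<Rightarrow> rat"
  assumes "u \<noteq> 0" and "v \<noteq> 0"
    and "subsemigroup S" and "S \<noteq> {0}"
    and "finite_rows u v B"
  shows "\<exists>C :: nat \<Rightarrow> nat \<Rightarrow> rat. finite_rows v v C \<and>
           {x \<in> vecs v (S - {0}). mat_vec u v B x = zero_vec u}
             = {mat_vec v v C y | y. y \<in> vecs v (S - {0})} \<inter> vecs v (S - {0}) \<and>
           (kernel_partition_regular S u v B \<longleftrightarrow> image_partition_regular S v v C)"
proof -
  let ?K = "{x \<in> vecs v (S - {0}). mat_vec u v B x = zero_vec u}"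
  obtain C where C: "finite_rows v v C"
    and fixed: "\<And>x i. x \<in> ?K \<Longrightarrow> i \<in> idx v \<Longrightarrow> mat_vec v v C x i = x i"
    and image: "\<And>y. mat_vec u v B (mat_vec v v C y) = zero_vec u"
    using exists_projection_onto_kernel[OF assms(5), of ?K] by auto
  \<comment> \<open>Off \<open>idx v\<close> both vectors are \<open>undefined\<close>, so agreement
    on \<open>idx v\<close> gives equality of functions.\<close>
  have "mat_vec v v C x = x" if "x \<in> ?K" for x
  proof
    fix i
    show "mat_vec v v C x i = x i"
      using fixed[OF that, of i] that
      by (cases "i \<in> idx v") (auto simp: mat_vec_def vecs_def PiE_def extensional_def)
  qed
  then have eq: "?K = {mat_vec v v C y | y. y \<in> vecs v (S - {0})} \<inter> vecs v (S - {0})"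
    using image by force
  \<comment> \<open>For each colouring, both regularity properties ask for a monochromatic member of
    one and the same set, described by the two sides of \<open>eq\<close>.\<close>
  have "(\<exists>x\<in>vecs v (S - {0}). mat_vec u v B x = zero_vec u \<and> monochromatic \<chi> (x ` idx v))
      \<longleftrightarrow> (\<exists>y\<in>vecs v (S - {0}). mat_vec v v C y \<in> vecs v (S - {0}) \<and>
           monochromatic \<chi> (mat_vec v v C y ` idx v))" (is "?ker \<longleftrightarrow> ?im") for \<chi>
  proof -
    have "?ker \<longleftrightarrow> (\<exists>x\<in>?K. monochromatic \<chi> (x ` idx v))" by blast
    also have "\<dots> \<longleftrightarrow> ?im" unfolding eq by blast
    finally show ?thesis .
  qed
  then show ?thesis
    using C eq unfolding kernel_partition_regular_def image_partition_regular_def by blast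
qed

end
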